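(* There exists a Sidon set in $\mathbb{F}_2^{15}$ of size $192$.
   Context: A subset $M\subseteq\mathbb{F}_2^t$ is called a Sidon set if $m_1+m_2\neq m_3+m_4$ for all pairwise distinct $m_1,m_2,m_3,m_4\in M$; equivalently, the sum of any four distinct elements of $M$ is different from $0$. *)

theory Defs
  imports "HOL-Analysis.Finite_Cartesian_Product" "HOL-Library.Z2"
begin

text \<open>The space $F_2^t$ is rendered as \<^typ>\<open>bit ^ 't::finite\<close> with componentwise addition,
  where \<^typ>\<open>bit\<close> is the field with two elements and $t$ is the cardinality of the index type.\<close>

definition sidon :: "(bit ^ 't::finite) set \<Rightarrow> bool" where
  "sidon M \<longleftrightarrow> (\<forall>m1\<in>M. \<forall>m2\<in>M. \<forall>m3\<in>M. \<forall>m4\<in>M.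
     distinct [m1, m2, m3, m4] \<longrightarrow> m1 + m2 \<noteq> m3 + m4)"

end

theory Submission
  imports Defs
begin

text \<open>Let $f = (f_0, f_1, \dots, f_7)$ be a quadratic map from $F_2^8$ to itself, and let
  $\beta_k(u, v) = f_k(x + u + v) + f_k(x + u) + f_k(x + v) + f_k(x)$ be the bilinear form polar to
  $f_k$. If no two distinct nonzero vectors $u, v$ satisfy $\beta_0(u, v) = \dots = \beta_7(u, v) = 0$
  (that is, if $f$ is almost perfect nonlinear), then the graph of $(f_1, \dots, f_7)$ over the zeros
  of $f_0$ is a Sidon set in $F_2^{15}$: a relation $a + b = c + d$ between its points forces all
  $\beta_k$ to vanish at $u = a + b$, $v = a + c$. With $f_0 = x_0 x_1$ there are $3 \cdot 2^6 = 192$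
  zeros, so it suffices to exhibit such an $f$. The one below was found by a computer search among the
  quadratic maps whose polar form is equivariant under a linear automorphism of order 3. As $\beta_k$
  is alternating, $f$ is almost perfect nonlinear as soon as, for every $u \neq 0$, Gaussian
  elimination leaves at most one free variable in the system $\beta_k(u, v) = 0$ for $v$.\<close>

section \<open>Quadratic forms over the field with two elements\<close>

text \<open>For the sake of evaluation, vectors over $F_2$ are lists of truth values, so that the sum is
  \<^term>\<open>(\<noteq>)\<close> and the product is \<^term>\<open>(\<and>)\<close>.\<close>

definition xor_list :: "bool list \<Rightarrow> bool list \<Rightarrow> bool list" (infixl "\<oplus>" 65) where
  "xs \<oplus> ys = map2 (\<noteq>) xs ys"

lemma xor_list_simps [simp]:
  "[] \<oplus> ys = []"
  "(x # xs) \<oplus> (y # ys) = (x \<noteq> y) # (xs \<oplus> ys)"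
  "length (xs \<oplus> ys) = min (length xs) (length ys)"
  by (simp_all add: xor_list_def)

fun dot :: "bool list \<Rightarrow> bool list \<Rightarrow> bool" where
  "dot (x # xs) (y # ys) \<longleftrightarrow> (x \<and> y) \<noteq> dot xs ys"
| "dot _ _ \<longleftrightarrow> False"

text \<open>Row $i$ of \<open>A\<close> lists the coefficients of $x_i x_j$ for $j = i + 1, i + 2, \dots$\<close>

fun quad :: "bool list list \<Rightarrow> bool list \<Rightarrow> bool" where
  "quad (r # A) (x # xs) \<longleftrightarrow> (x \<and> dot r xs) \<noteq> quad A xs"
| "quad _ _ \<longleftrightarrow> False"

text \<open>Rows may differ in length. The shorter one is continued by zeros, which agrees with
  \<open>dot\<close>, so \<open>[]\<close> acts as the zero vector of every dimension.\<close>

fun padded_xor :: "bool list \<Rightarrow> bool list \<Rightarrow> bool list" where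
  "padded_xor (x # xs) (y # ys) = (x \<noteq> y) # padded_xor xs ys"
| "padded_xor xs [] = xs"
| "padded_xor [] ys = ys"

text \<open>The vector representing the linear form $v \mapsto \beta(u, v)$, where $\beta$ is polar to \<open>quad A\<close>.\<close>

fun polar_row :: "bool list list \<Rightarrow> bool list \<Rightarrow> bool list" where
  "polar_row (r # A) (x # xs) = dot r xs # padded_xor (if x then r else []) (polar_row A xs)"
| "polar_row _ _ = []"

lemma dot_Nil2 [simp]: "dot xs [] \<longleftrightarrow> False"
  by (cases xs) auto

lemma dot_xor_list:
  assumes "length xs = length ys"
  shows "dot r (xs \<oplus> ys) \<longleftrightarrow> dot r xs \<noteq> dot r ys"
  using assms
proof (induction xs ys arbitrary: r rule: list_induct2)
  case (Cons x xs y ys)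
  then show ?case by (cases r) auto
qed simp

lemma dot_padded_xor: "dot (padded_xor r s) ys \<longleftrightarrow> dot r ys \<noteq> dot s ys"
proof (induction r s arbitrary: ys rule: padded_xor.induct)
  case (1 x xs y ys zs)
  then show ?case by (cases zs) auto
qed auto

text \<open>Splitting off the first variable writes the form as a (r . x) + q(x). The product a (r .
  x) has polar form b (r . v) + c (r . u), and induction handles q.\<close>

lemma quad_polarization:
  assumes "length x = length u" "length u = length v"
  shows "dot (polar_row A u) v \<longleftrightarrow>
    ((quad A (x \<oplus> u \<oplus> v) \<noteq> quad A (x \<oplus> u)) \<noteq> (quad A (x \<oplus> v) \<noteq> quad A x))"
  using assms
proof (induction x u v arbitrary: A rule: list_induct3)
  case Cons_vec: (Cons a x b u c v)
  show ?case
  proof (cases A)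
    case (Cons r B)
    have "dot (polar_row A (b # u)) (c # v) \<longleftrightarrow>
        (c \<and> dot r u) \<noteq> ((b \<and> dot r v) \<noteq> dot (polar_row B u) v)"
      by (simp add: Cons dot_padded_xor conj_commute)
    then show ?thesis
      unfolding Cons_vec.IH[of B]
      by (cases a; cases b; cases c) (simp_all add: Cons Cons_vec.hyps dot_xor_list, argo+)
  qed simp
qed simp

lemma xor_list_cancel_left: "length xs = length ys \<Longrightarrow> xs \<oplus> (xs \<oplus> ys) = ys"
  by (induction xs ys rule: list_induct2) auto

lemma xor_list_eq_iff:
  assumes "length xs = length ys" "length ys = length zs"
  shows "xs \<oplus> ys = xs \<oplus> zs \<longleftrightarrow> ys = zs"
  using assms by (induction xs ys zs rule: list_induct3) auto

lemma xor_list_zero_iff: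
  assumes "length xs = length ys"
  shows "True \<notin> set (xs \<oplus> ys) \<longleftrightarrow> xs = ys"
  using assms by (induction xs ys rule: list_induct2) auto

lemma xor_list_relation:
  assumes "length a = length b" "length b = length c" "length c = length d" "a \<oplus> b = c \<oplus> d"
  shows "d = a \<oplus> (a \<oplus> b) \<oplus> (a \<oplus> c)"
  using assms by (induction a b c d rule: list_induct4) auto

text \<open>Polarize at the base point u: for v = u the four values of the form cancel in
  pairs.\<close>

lemma polar_row_alternating: "\<not> dot (polar_row A u) u"
proof -
  have "u \<oplus> u \<oplus> u = u"
    by (induction u) auto
  then show ?thesis
    using quad_polarization[of u u u A] by auto
qed

lemma dot_zero_right: "True \<notin> set v \<Longrightarrow> \<not> dot r v"
  by (induction r v rule: dot.induct) auto

section \<open>Homogeneous linear systems\<close>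

fun lead :: "bool list \<Rightarrow> bool" where
  "lead (x # _) \<longleftrightarrow> x"
| "lead [] \<longleftrightarrow> False"

lemma dot_Cons2: "dot r (y # ys) \<longleftrightarrow> (lead r \<and> y) \<noteq> dot (tl r) ys"
  by (cases r) auto

definition eliminate :: "bool list \<Rightarrow> bool list \<Rightarrow> bool list" where
  "eliminate p r = (if lead r then padded_xor (tl r) (tl p) else tl r)"

text \<open>Counts the columns without a pivot. The pivot row may stay in the list, since
  \<open>eliminate p p\<close> is a zero row.\<close>

fun free_count :: "nat \<Rightarrow> bool list list \<Rightarrow> nat" where
  "free_count 0 rs = 0"
| "free_count (Suc n) rs = (case find lead rs of
     None \<Rightarrow> Suc (free_count n (map tl rs))
   | Some p \<Rightarrow> free_count n (map (eliminate p) rs))"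

definition solutions :: "nat \<Rightarrow> bool list list \<Rightarrow> bool list set" where
  "solutions n rs = {v. length v = n \<and> (\<forall>r\<in>set rs. \<not> dot r v)}"

lemma finite_solutions: "finite (solutions n rs)"
  by (rule finite_subset[OF _ finite_lists_length_eq[of "UNIV :: bool set" n]])
    (auto simp: solutions_def)

text \<open>Without a pivot the first coordinate is free and at most doubles the count. With a pivot
  \<open>p\<close>, the equation of \<open>p\<close> determines it from the others, so dropping it
  is injective.\<close>

lemma card_solutions: "card (solutions n rs) \<le> 2 ^ free_count n rs"
proof (induction n arbitrary: rs)
  case 0
  have "solutions 0 rs = {[]}"
    by (auto simp: solutions_def)
  then show ?case by simp
next
  case (Suc n)
  show ?case
  proof (cases "find lead rs")
    case None
    have "solutions (Suc n) rs \<subseteq> case_prod (#) ` (UNIV \<times> solutions n (map tl rs))"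
    proof
      fix v assume v: "v \<in> solutions (Suc n) rs"
      then obtain y ys where "v = y # ys"
        by (cases v) (auto simp: solutions_def)
      then show "v \<in> case_prod (#) ` (UNIV \<times> solutions n (map tl rs))"
        using v None by (force simp: solutions_def dot_Cons2 find_None_iff)
    qed
    then have "card (solutions (Suc n) rs) \<le> card (UNIV \<times> solutions n (map tl rs) :: (bool \<times> bool list) set)"
      by (meson surj_card_le finite_SigmaI finite finite_solutions)
    also have "\<dots> \<le> 2 * 2 ^ free_count n (map tl rs)"
      using Suc.IH by (simp add: card_cartesian_product)
    finally show ?thesis
      by (simp add: None)
  next
    case (Some p)
    then have p: "p \<in> set rs" "lead p"
      by (auto simp: find_Some_iff)
    have head: "y \<longleftrightarrow> dot (tl p) ys" if "y # ys \<in> solutions (Suc n) rs" for y ys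
      using that p by (auto simp: solutions_def dot_Cons2)
    have "inj_on tl (solutions (Suc n) rs)"
    proof (rule inj_onI)
      fix v w assume vw: "v \<in> solutions (Suc n) rs" "w \<in> solutions (Suc n) rs" "tl v = tl w"
      then obtain y z ys where "v = y # ys" "w = z # ys"
        by (cases v; cases w) (auto simp: solutions_def)
      then show "v = w"
        using vw head[of y ys] head[of z ys] by simp
    qed
    moreover have "tl ` solutions (Suc n) rs \<subseteq> solutions n (map (eliminate p) rs)"
    proof
      fix ys assume "ys \<in> tl ` solutions (Suc n) rs"
      then obtain y where y: "y # ys \<in> solutions (Suc n) rs"
        by (auto simp: solutions_def length_Suc_conv)
      then show "ys \<in> solutions n (map (eliminate p) rs)"
        using head[OF y] by (auto simp: solutions_def eliminate_def dot_Cons2 dot_padded_xor)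
    qed
    ultimately have "card (solutions (Suc n) rs) \<le> card (solutions n (map (eliminate p) rs))"
      by (rule card_inj_on_le) (rule finite_solutions)
    also have "\<dots> \<le> 2 ^ free_count n (map (eliminate p) rs)"
      by (rule Suc.IH)
    finally show ?thesis
      by (simp add: Some)
  qed
qed

section \<open>Graphs of almost perfect nonlinear maps\<close>

definition apn_forms :: "nat \<Rightarrow> bool list list list \<Rightarrow> bool" where
  "apn_forms n As \<longleftrightarrow> (\<forall>u v. length u = n \<longrightarrow> length v = n \<longrightarrow>
     (\<forall>A\<in>set As. \<not> dot (polar_row A u) v) \<longrightarrow> True \<notin> set u \<or> True \<notin> set v \<or> u = v)"

lemma apn_formsI:
  assumes "\<And>u. length u = n \<Longrightarrow> True \<in> set u \<Longrightarrow> free_count n (map (\<lambda>A. polar_row A u) As) \<le> 1"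
  shows "apn_forms n As"
  unfolding apn_forms_def
proof (intro allI impI, rule ccontr)
  fix u v
  assume uv: "length u = n" "length v = n" "\<forall>A\<in>set As. \<not> dot (polar_row A u) v"
    and "\<not> (True \<notin> set u \<or> True \<notin> set v \<or> u = v)"
  then have nz: "True \<in> set u" "True \<in> set v" "u \<noteq> v"
    by auto
  let ?rs = "map (\<lambda>A. polar_row A u) As" and ?o = "replicate n False"
  have "?o \<noteq> u" "?o \<noteq> v"
    using nz by (metis in_set_replicate)+
  \<comment> \<open>As the polar forms are alternating, u itself is a solution besides 0 and v:
    three solutions where at most two are possible.\<close>
  then have "3 = card {?o, u, v}"
    using nz by simp
  also have "{?o, u, v} \<subseteq> solutions n ?rs"
    using uv polar_row_alternating dot_zero_right[of ?o] by (auto simp: solutions_def)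
  then have "card {?o, u, v} \<le> card (solutions n ?rs)"
    by (rule card_mono[OF finite_solutions])
  also have "\<dots> \<le> 2 ^ free_count n ?rs"
    by (rule card_solutions)
  also have "\<dots> \<le> 2 ^ 1"
    using assms[OF uv(1) nz(1)] by (intro power_increasing) auto
  finally show False by simp
qed

lemma apn_forms_sum_free:
  assumes apn: "apn_forms n As"
    and len: "length a = n" "length b = n" "length c = n" "length d = n"
    and sum: "a \<oplus> b = c \<oplus> d"
    and quad: "\<forall>A\<in>set As. (quad A a \<noteq> quad A b) = (quad A c \<noteq> quad A d)"
  shows "a = b \<or> a = c \<or> b = c"
proof -
  define u v where "u = a \<oplus> b" and "v = a \<oplus> c"
  have luv: "length u = n" "length v = n"
    by (simp_all add: u_def v_def len)
  have b: "b = a \<oplus> u" and c: "c = a \<oplus> v" and d: "d = a \<oplus> u \<oplus> v"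
    using xor_list_cancel_left[of a b] xor_list_cancel_left[of a c]
      xor_list_relation[of a b c d] len sum
    by (simp_all add: u_def v_def)
  have "\<not> dot (polar_row A u) v" if "A \<in> set As" for A
  proof -
    have "dot (polar_row A u) v \<longleftrightarrow>
        ((quad A d \<noteq> quad A b) \<noteq> (quad A c \<noteq> quad A a))"
      unfolding b c d by (rule quad_polarization) (simp_all add: luv len(1))
    then show ?thesis
      using quad that by auto
  qed
  then have "True \<notin> set u \<or> True \<notin> set v \<or> u = v"
    using apn luv unfolding apn_forms_def by blast
  \<comment> \<open>The cases u = 0, v = 0 and u = v mean a = b, a = c and b = c.\<close>
  then show ?thesis
    using xor_list_zero_iff[of a b] xor_list_zero_iff[of a c] xor_list_eq_iff[of a b c] len
    by (auto simp: u_def v_def)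
qed

definition graph_point :: "bool list list list \<Rightarrow> bool list \<Rightarrow> bool list" where
  "graph_point As xs = xs @ map (\<lambda>A. quad A xs) As"

text \<open>\<open>h\<close> numbers the coordinates; any numbering will do, because the Sidon
  property does not depend on their order.\<close>

definition vec_of_list :: "('t \<Rightarrow> nat) \<Rightarrow> bool list \<Rightarrow> bit ^ 't::finite" where
  "vec_of_list h xs = (\<chi> i. of_bool (xs ! h i))"

lemma vec_of_list_add:
  assumes "length xs = length ys" "range h \<subseteq> {..<length ys}"
  shows "vec_of_list h xs + vec_of_list h ys = vec_of_list h (xs \<oplus> ys)"
proof -
  have "h i < length ys" for i
    using assms(2) by auto
  then show ?thesis
    using assms(1) by (simp add: vec_of_list_def vec_eq_iff xor_list_def)
qed

lemma vec_of_list_inject: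
  assumes "length xs = length ys" "range h = {..<length ys}"
  shows "vec_of_list h xs = vec_of_list h ys \<longleftrightarrow> xs = ys"
proof
  assume eq: "vec_of_list h xs = vec_of_list h ys"
  show "xs = ys"
  proof (rule nth_equalityI)
    fix k assume "k < length xs"
    then obtain i where "k = h i"
      using assms by (metis imageE lessThan_iff)
    moreover have "vec_of_list h xs $ i = vec_of_list h ys $ i"
      using eq by simp
    ultimately show "xs ! k = ys ! k"
      by (simp add: vec_of_list_def of_bool_eq_iff)
  qed (fact assms(1))
qed simp

lemma map2_map_map: "map2 f (map g xs) (map h xs) = map (\<lambda>x. f (g x) (h x)) xs"
  by (induction xs) auto

lemma sidon_quadratic_graph:
  fixes h :: "'t::finite \<Rightarrow> nat"
  assumes apn: "apn_forms n (A0 # As)" and h: "bij_betw h UNIV {..<n + length As}"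
    and Z: "Z = {xs. length xs = n \<and> \<not> quad A0 xs}"
  shows "sidon ((vec_of_list h \<circ> graph_point As) ` Z)"
    and "inj_on (vec_of_list h \<circ> graph_point As) Z"
proof -
  have range: "range h = {..<n + length As}"
    using h by (simp add: bij_betw_def)
  have len: "length (graph_point As xs) = n + length As" if "xs \<in> Z" for xs
    using that by (simp add: graph_point_def Z)
  have sum_free: "a = b \<or> a = c \<or> b = c"
    if Z': "a \<in> Z" "b \<in> Z" "c \<in> Z" "d \<in> Z"
      and eq: "vec_of_list h (graph_point As a) + vec_of_list h (graph_point As b)
             = vec_of_list h (graph_point As c) + vec_of_list h (graph_point As d)" for a b c d
  proof -
    have l: "length a = n" "length b = n" "length c = n" "length d = n"
      using Z' by (simp_all add: Z)
    have "graph_point As a \<oplus> graph_point As b = graph_point As c \<oplus> graph_point As d"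
      using eq Z' by (simp add: vec_of_list_add vec_of_list_inject len range)
    then have "a \<oplus> b = c \<oplus> d"
      and "map (\<lambda>A. quad A a \<noteq> quad A b) As = map (\<lambda>A. quad A c \<noteq> quad A d) As"
      using l by (simp_all add: graph_point_def xor_list_def map2_map_map)
    \<comment> \<open>The relation for \<open>A0\<close> holds because \<open>A0\<close> vanishes on
      \<open>Z\<close>; those for \<open>As\<close> are read off the graph coordinates.\<close>
    then show ?thesis
      using apn_forms_sum_free[OF apn l] Z' by (auto simp: Z)
  qed
  show "sidon ((vec_of_list h \<circ> graph_point As) ` Z)"
    unfolding sidon_def using sum_free by fastforce
  show "inj_on (vec_of_list h \<circ> graph_point As) Z"
  proof (rule inj_onI)
    fix xs ys
    assume xy: "xs \<in> Z" "ys \<in> Z"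
      and "(vec_of_list h \<circ> graph_point As) xs = (vec_of_list h \<circ> graph_point As) ys"
    then have "graph_point As xs = graph_point As ys"
      by (simp add: vec_of_list_inject len range)
    then show "xs = ys"
      using xy by (simp add: graph_point_def Z)
  qed
qed

section \<open>An almost perfect nonlinear map in dimension eight\<close>

abbreviation "F \<equiv> False"
abbreviation "T \<equiv> True"

text \<open>Seven rows describe a form in eight variables, as the last variable has no later
  partner.\<close>

definition x0x1 :: "bool list list" where
  "x0x1 =
    [[T, F, F, F, F, F, F],
     [F, F, F, F, F, F],
     [F, F, F, F, F],
     [F, F, F, F],
     [F, F, F],
     [F, F],
     [F]]"

definition seven_forms :: "bool list list list" where
  "seven_forms =
    [[[T, F, F, T, T, F, F],
      [F, F, F, T, F, F],
      [F, F, T, F, T],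
      [T, F, T, F],
      [T, T, F],
      [T, T],
      [T]],
     [[F, F, T, T, F, T, F],
      [T, F, T, T, T, T],
      [F, F, T, T, F],
      [T, F, T, T],
      [F, T, F],
      [T, T],
      [T]],
     [[T, T, T, T, F, F, T],
      [F, T, T, T, T, F],
      [F, T, F, F, T],
      [T, T, T, F],
      [F, T, F],
      [T, T],
      [T]],
     [[F, F, T, F, T, T, T],
      [T, F, T, F, F, T],
      [F, F, T, T, T],
      [T, F, F, T],
      [F, F, F],
      [F, F],
      [T]],
     [[F, F, F, T, F, F, F],
      [F, F, T, T, F, F],
      [T, F, T, T, F],
      [T, F, T, T],
      [T, F, T],
      [T, F],
      [F]],
     [[F, T, T, F, F, T, T],
      [T, F, F, F, T, F],
      [F, F, T, F, T],
      [T, T, T, T],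
      [F, T, F],
      [F, T],
      [F]],
     [[F, F, T, F, F, F, T],
      [T, T, F, F, T, T],
      [F, T, F, T, F],
      [F, T, F, T],
      [F, T, T],
      [T, F],
      [F]]]"

lemma set_n_lists_bool: "set (List.n_lists n [False, True]) = {xs. length xs = n}"
  by (auto simp: set_n_lists)

text \<open>One elimination for each of the 255 nonzero u replaces a test of all pairs u, v.\<close>

lemma apn_check_seven_forms:
  "list_all (\<lambda>u. list_ex id u \<longrightarrow> free_count 8 (map (\<lambda>A. polar_row A u) (x0x1 # seven_forms)) \<le> 1)
     (List.n_lists 8 [False, True])"
  by code_simp

lemma apn_forms_seven_forms: "apn_forms 8 (x0x1 # seven_forms)"
proof (rule apn_formsI)
  fix u :: "bool list"
  assume "length u = 8" "True \<in> set u"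
  moreover from this have "u \<in> set (List.n_lists 8 [False, True])" "list_ex id u"
    by (auto simp: set_n_lists_bool list_ex_iff)
  ultimately show "free_count 8 (map (\<lambda>A. polar_row A u) (x0x1 # seven_forms)) \<le> 1"
    using apn_check_seven_forms unfolding list_all_iff by blast
qed

lemma card_zeros_x0x1: "card {xs. length xs = 8 \<and> \<not> quad x0x1 xs} = 192"
proof -
  have "{xs. length xs = 8 \<and> \<not> quad x0x1 xs}
      = set (filter (\<lambda>xs. \<not> quad x0x1 xs) (List.n_lists 8 [False, True]))"
    unfolding set_filter set_n_lists_bool by blast
  moreover have "length (filter (\<lambda>xs. \<not> quad x0x1 xs) (List.n_lists 8 [False, True])) = 192"
    by code_simp
  moreover have "distinct (List.n_lists 8 [False, True])"
    by (intro distinct_n_lists) simp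
  ultimately show ?thesis
    by (metis distinct_card distinct_filter)
qed

theorem theorem4p1:
  "\<exists>M :: (bit ^ 15) set. sidon M \<and> card M = 192"
proof -
  \<comment> \<open>The 15 coordinates are the 8 arguments followed by the 7 values of the
    forms.\<close>
  obtain h :: "15 \<Rightarrow> nat" where h: "bij_betw h UNIV {..<8 + length seven_forms}"
    using ex_bij_betw_finite_nat[of "UNIV :: 15 set"]
    by (auto simp: seven_forms_def atLeast0LessThan)
  note graph = sidon_quadratic_graph[OF apn_forms_seven_forms h refl]
  show ?thesis
    using graph(1) card_image[OF graph(2)] card_zeros_x0x1 by metis
qed

end
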